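(* Let $\mathfrak{M}$ be a non-empty class of metric spaces. The following statements hold. (i) If $\mathfrak{A}$ and $\mathfrak{B}$ are minimal $\mathfrak{M}$-universal classes of metric spaces, then $\mathfrak{A}\simeq\mathfrak{B}$. (ii) If there exists a minimal $\mathfrak{M}$-universal class $\mathfrak{A}$ of metric spaces, then there exists $\mathfrak{B}\subseteq\mathfrak{M}$ such that $\mathfrak{A}\simeq\mathfrak{B}$.
   Context: For metric spaces $X,Y$, write $X\hookrightarrow Y$ if there is an isometric embedding (distance-preserving map) of $X$ in $Y$, and $X\simeq Y$ if $X$ and $Y$ are isometric (there is a surjective isometric embedding). The empty metric space is allowed: $\varnothing\hookrightarrow Y$ for every $Y$, and $Y\hookrightarrow\varnothing$ iff $Y=\varnothing$. For metric spaces, $X\subseteq Y$ means that $X$ is a subspace of $Y$ with the induced metric. Metric spaces $X,Y$ are comparable if $X\hookrightarrow Y$ or $Y\hookrightarrow X$; otherwise they are incomparable. For classes $\mathfrak{M},\mathfrak{B}$ of metric spaces: $\mathfrak{M}\hookrightarrow\mathfrak{B}$ means that for every $X\in\mathfrak{M}$ there is $Y\in\mathfrak{B}$ with $X\hookrightarrow Y$ (then $\mathfrak{B}$ is called $\mathfrak{M}$-universal); $\mathfrak{M}\preceq\mathfrak{B}$ means that for every $X\in\mathfrak{M}$ there is $Y\in\mathfrak{B}$ with $X\subseteq Y$. A class $\mathfrak{A}$ is minimal $\mathfrak{M}$-universal if: (a) $\mathfrak{M}\hookrightarrow\mathfrak{A}$; (b) for every class $\mathfrak{B}$ of metric spaces,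 $(\mathfrak{M}\hookrightarrow\mathfrak{B})\wedge(\mathfrak{B}\preceq\mathfrak{A})$ implies $\mathfrak{A}\preceq\mathfrak{B}$; (c) distinct elements of $\mathfrak{A}$ are incomparable metric spaces. Classes $\mathfrak{A},\mathfrak{B}$ of metric spaces are isomorphic, written $\mathfrak{A}\simeq\mathfrak{B}$, if there is a bijective map $F:\mathfrak{A}\to\mathfrak{B}$ with $F(X)\simeq X$ for every $X\in\mathfrak{A}$. *)

theory Defs
  imports "HOL-Analysis.Analysis"
begin

text \<open>
  The library type \<^typ>\<open>'a metric\<close> leaves the values of the distance outside the carrier
  arbitrary, so that one metric space has many representations there. The type below fixes the
  value 0 outside the carrier. Then equality is equality of metric spaces (lemma
  \<open>ext_metric_eq_iff\<close>), which matters for ``distinct elements of a class'' and for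
  bijections between classes. The empty metric space belongs to the type.
\<close>

typedef 'a ext_metric =
    "{m :: 'a metric. \<forall>x y. x \<notin> mspace m \<or> y \<notin> mspace m \<longrightarrow> mdist m x y = 0}"
  morphisms metric_of ext_metric
proof -
  have "Metric_space ({} :: 'a set) (\<lambda>x y. 0)"
    by (auto simp: Metric_space_def)
  then have "mdist (metric ({} :: 'a set, \<lambda>x y. 0)) = (\<lambda>x y. 0)"
    by (rule Metric_space.mdist_metric)
  then show ?thesis
    by (auto intro!: exI[of _ "metric ({}, \<lambda>x y. 0)"])
qed

abbreviation points :: "'a ext_metric \<Rightarrow> 'a set" where
  "points X \<equiv> mspace (metric_of X)"

abbreviation distance :: "'a ext_metric \<Rightarrow> 'a \<Rightarrow> 'a \<Rightarrow> real" where
  "distance X \<equiv> mdist (metric_of X)"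

lemma distance_outside: "x \<notin> points X \<or> y \<notin> points X \<Longrightarrow> distance X x y = 0"
  using metric_of[of X] by blast

lemma ext_metric_eq_iff:
  "X = Y \<longleftrightarrow> points X = points Y \<and> (\<forall>x\<in>points X. \<forall>y\<in>points X. distance X x y = distance Y x y)"
proof
  assume *: "points X = points Y \<and>
    (\<forall>x\<in>points X. \<forall>y\<in>points X. distance X x y = distance Y x y)"
  have "distance X x y = distance Y x y" for x y
    using * distance_outside[of x X y] distance_outside[of x Y y] by (metis (full_types))
  then have "distance X = distance Y"
    by blast
  with * have "dest_metric (metric_of X) = dest_metric (metric_of Y)"
    by (simp add: mspace_def mdist_def prod_eq_iff)
  then show "X = Y"
    by (simp add: dest_metric_inject metric_of_inject)
qed simp

text \<open>
  A class of metric spaces with points in \<^typ>\<open>'a\<close> is a set of type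
  \<open>'a ext_metric set\<close>. Different classes may draw their points from different types.
\<close>

definition isometric_embedding :: "('a \<Rightarrow> 'b) \<Rightarrow> 'a ext_metric \<Rightarrow> 'b ext_metric \<Rightarrow> bool" where
  "isometric_embedding f X Y \<longleftrightarrow> f \<in> points X \<rightarrow> points Y \<and>
     (\<forall>x\<in>points X. \<forall>y\<in>points X. distance Y (f x) (f y) = distance X x y)"

definition embeds :: "'a ext_metric \<Rightarrow> 'b ext_metric \<Rightarrow> bool" where
  "embeds X Y \<longleftrightarrow> (\<exists>f. isometric_embedding f X Y)"

definition isometric :: "'a ext_metric \<Rightarrow> 'b ext_metric \<Rightarrow> bool" where
  "isometric X Y \<longleftrightarrow> (\<exists>f. isometric_embedding f X Y \<and> f ` points X = points Y)"

definition subspace_of :: "'a ext_metric \<Rightarrow> 'a ext_metric \<Rightarrow> bool" where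
  "subspace_of X Y \<longleftrightarrow> points X \<subseteq> points Y \<and>
     (\<forall>x\<in>points X. \<forall>y\<in>points X. distance X x y = distance Y x y)"

definition comparable :: "'a ext_metric \<Rightarrow> 'b ext_metric \<Rightarrow> bool" where
  "comparable X Y \<longleftrightarrow> embeds X Y \<or> embeds Y X"

text \<open>\<open>class_embeds M B\<close> says that \<open>B\<close> is \<open>M\<close>-universal.\<close>

definition class_embeds :: "'a ext_metric set \<Rightarrow> 'b ext_metric set \<Rightarrow> bool" where
  "class_embeds M B \<longleftrightarrow> (\<forall>X\<in>M. \<exists>Y\<in>B. embeds X Y)"

definition class_preceq :: "'a ext_metric set \<Rightarrow> 'a ext_metric set \<Rightarrow> bool" where
  "class_preceq M B \<longleftrightarrow> (\<forall>X\<in>M. \<exists>Y\<in>B. subspace_of X Y)"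

text \<open>
  In the second clause it is no restriction that \<open>B\<close> has the same point type as \<open>A\<close>: the
  members of \<open>B\<close> are required to be subspaces of members of \<open>A\<close>.
\<close>

definition minimal_universal :: "'m ext_metric set \<Rightarrow> 'a ext_metric set \<Rightarrow> bool" where
  "minimal_universal M A \<longleftrightarrow>
     class_embeds M A \<and>
     (\<forall>B :: 'a ext_metric set. class_embeds M B \<and> class_preceq B A \<longrightarrow> class_preceq A B) \<and>
     (\<forall>X\<in>A. \<forall>Y\<in>A. X \<noteq> Y \<longrightarrow> \<not> comparable X Y)"

definition class_isomorphic :: "'a ext_metric set \<Rightarrow> 'b ext_metric set \<Rightarrow> bool" where
  "class_isomorphic A B \<longleftrightarrow> (\<exists>F. bij_betw F A B \<and> (\<forall>X\<in>A. isometric (F X) X))"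

end

theory Submission
  imports Defs
begin

text \<open>
  The key observation concerns a minimal \<open>M\<close>-universal class \<open>A\<close> and any class \<open>C\<close> that lies
  between \<open>M\<close> and \<open>A\<close> with respect to embeddability. Replacing each member of \<open>C\<close> by its
  isometric image inside some member of \<open>A\<close> gives a universal class of subspaces of members
  of \<open>A\<close>, so minimality puts each \<open>Z \<in> A\<close> inside such an image, which in turn lies in some
  \<open>Y \<in> A\<close>. Incomparability forces \<open>Z = Y\<close>, so \<open>Z\<close> is squeezed between the image and itself.
  Hence each member of \<open>A\<close> is isometric to a member of \<open>C\<close>
  (lemma \<open>minimal_universal_isometric_member\<close>).

  The choice \<open>C = M\<close> gives the second claim. For the first claim, mutual embeddability of
  corresponding members of two minimal universal classes is not enough, since it does not imply
  isometry. But as the members of each class are isometric copies of members of \<open>M\<close>, each class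
  embeds in the other, and so each may be taken for \<open>C\<close> with respect to the other: every
  member of either is isometric to a member of the other. Incomparability of distinct members
  turns this correspondence into a bijection.
\<close>

lemma isometric_embedding_compose:
  assumes "isometric_embedding f X Y" "isometric_embedding g Y Z"
  shows "isometric_embedding (g \<circ> f) X Z"
  using assms by (auto simp: isometric_embedding_def Pi_iff)

lemma embeds_trans: "embeds X Y \<Longrightarrow> embeds Y Z \<Longrightarrow> embeds X Z"
  unfolding embeds_def by (blast intro: isometric_embedding_compose)

lemma class_embeds_trans: "class_embeds M B \<Longrightarrow> class_embeds B C \<Longrightarrow> class_embeds M C"
  unfolding class_embeds_def by (meson embeds_trans)

lemma isometric_imp_embeds: "isometric X Y \<Longrightarrow> embeds X Y"
  unfolding isometric_def embeds_def by blast

lemma isometric_sym: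
  assumes "isometric X Y"
  shows "isometric Y X"
proof -
  obtain f where f: "isometric_embedding f X Y" and onto: "f ` points X = points Y"
    using assms by (auto simp: isometric_def)
  have dist: "distance Y (f x) (f y) = distance X x y" if "x \<in> points X" "y \<in> points X" for x y
    using f that by (simp add: isometric_embedding_def)
  have "inj_on f (points X)"
  proof (rule inj_onI)
    fix x y assume xy: "x \<in> points X" "y \<in> points X" and eq: "f x = f y"
    have "f x \<in> points Y"
      using xy(1) onto by blast
    then have "distance Y (f x) (f y) = 0"
      by (simp add: eq)
    then have "distance X x y = 0"
      by (simp add: dist[OF xy])
    then show "x = y"
      using xy by simp
  qed
  then have bij: "bij_betw f (points X) (points Y)"
    using onto by (simp add: bij_betw_def)
  define g where "g = inv_into (points X) f"
  have g: "bij_betw g (points Y) (points X)"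
    unfolding g_def by (rule bij_betw_inv_into[OF bij])
  have fg: "f (g y) = y" if "y \<in> points Y" for y
    unfolding g_def by (rule bij_betw_inv_into_right[OF bij that])
  have gX: "g y \<in> points X" if "y \<in> points Y" for y
    by (rule bij_betw_apply[OF g that])
  have "isometric_embedding g Y X"
    unfolding isometric_embedding_def using dist[OF gX gX] fg gX by auto
  then show ?thesis
    unfolding isometric_def using bij_betw_imp_surj_on[OF g] by blast
qed

lemma subspace_of_imp_embeds:
  assumes "subspace_of X Y"
  shows "embeds X Y"
proof -
  have "isometric_embedding id X Y"
    using assms by (auto simp: isometric_embedding_def subspace_of_def)
  then show ?thesis
    unfolding embeds_def by blast
qed

lemma class_embeds_refl: "class_embeds M M"
proof -
  have "embeds X X" for X :: "'a ext_metric"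
    by (rule subspace_of_imp_embeds) (simp add: subspace_of_def)
  then show ?thesis
    unfolding class_embeds_def by blast
qed

lemma subspace_of_antisym: "subspace_of X Y \<Longrightarrow> subspace_of Y X \<Longrightarrow> X = Y"
  by (auto simp: subspace_of_def ext_metric_eq_iff)

lemma subspace_of_trans: "subspace_of X Y \<Longrightarrow> subspace_of Y Z \<Longrightarrow> subspace_of X Z"
  by (auto simp: subspace_of_def subset_iff)

lemma subspace_exists:
  assumes "S \<subseteq> points Y"
  obtains W where "points W = S" "subspace_of W Y"
proof -
  \<comment> \<open>The induced metric is cut off outside \<open>S\<close>, as the type demands; on \<open>S\<close> this is invisible.\<close>
  define d where "d x y = (if x \<in> S \<and> y \<in> S then distance Y x y else 0)" for x y
  have S: "x \<in> S \<Longrightarrow> x \<in> points Y" for x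
    using assms by blast
  have "Metric_space S d"
    by unfold_locales (auto simp: d_def S mdist_commute intro!: mdist_triangle)
  then have m: "mspace (metric (S, d)) = S" "mdist (metric (S, d)) = d"
    by (rule Metric_space.mspace_metric, rule Metric_space.mdist_metric)
  have W: "metric_of (ext_metric (metric (S, d))) = metric (S, d)"
    by (rule ext_metric_inverse) (auto simp: m d_def)
  show thesis
    by (rule that[of "ext_metric (metric (S, d))"])
       (use assms in \<open>auto simp: W m subspace_of_def d_def\<close>)
qed

lemma embeds_obtains_subspace:
  assumes "embeds X Y"
  obtains W where "subspace_of W Y" "isometric X W"
proof -
  obtain f where f: "isometric_embedding f X Y"
    using assms by (auto simp: embeds_def)
  then have "f ` points X \<subseteq> points Y"
    by (auto simp: isometric_embedding_def)
  then obtain W where W: "points W = f ` points X" "subspace_of W Y"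
    by (rule subspace_exists)
  then have "isometric_embedding f X W"
    using f by (simp add: isometric_embedding_def subspace_of_def)
  then show thesis
    using that W by (auto simp: isometric_def)
qed

lemma minimal_universal_eqI:
  assumes "minimal_universal M A" "X \<in> A" "Y \<in> A" "embeds X Y"
  shows "X = Y"
  using assms unfolding minimal_universal_def comparable_def by blast

text \<open>
  The isometric copies of the members of \<open>C\<close> inside members of \<open>A\<close> form a competitor for \<open>A\<close>
  in the minimality condition. All copies are taken rather than one for each member of \<open>C\<close>;
  the squeezing argument works for each of them.
\<close>

lemma minimal_universal_isometric_member:
  assumes A: "minimal_universal M A" and "class_embeds M C" "class_embeds C A" "Z \<in> A"
  obtains X where "X \<in> C" "isometric X Z"
proof -
  define B where "B = {W. \<exists>X\<in>C. \<exists>Y\<in>A. subspace_of W Y \<and> isometric X W}"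
  have "class_embeds C B"
    unfolding class_embeds_def
  proof
    fix X assume "X \<in> C"
    then obtain Y where "Y \<in> A" "embeds X Y"
      using assms(3) by (auto simp: class_embeds_def)
    from this(2) obtain W where "subspace_of W Y" "isometric X W"
      by (rule embeds_obtains_subspace)
    then have "W \<in> B" "embeds X W"
      using \<open>X \<in> C\<close> \<open>Y \<in> A\<close> by (auto simp: B_def isometric_imp_embeds)
    then show "\<exists>W\<in>B. embeds X W" ..
  qed
  then have "class_embeds M B"
    by (rule class_embeds_trans[OF assms(2)])
  moreover have "class_preceq B A"
    by (auto simp: B_def class_preceq_def)
  ultimately have "class_preceq A B"
    using A by (auto simp: minimal_universal_def)
  then obtain W where "W \<in> B" and ZW: "subspace_of Z W"
    using \<open>Z \<in> A\<close> by (auto simp: class_preceq_def)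
  then obtain X Y where X: "X \<in> C" "isometric X W" and Y: "Y \<in> A" and WY: "subspace_of W Y"
    by (auto simp: B_def)
  have "Z = Y"
    using minimal_universal_eqI[OF A \<open>Z \<in> A\<close> Y] subspace_of_trans[OF ZW WY]
    by (simp add: subspace_of_imp_embeds)
  with ZW WY have "W = Z"
    by (simp add: subspace_of_antisym)
  with X that show thesis
    by blast
qed

text \<open>
  Members of \<open>A\<close> with the same isometric partner embed in each other, so they are equal by
  incomparability; this is why any choice of partners is injective.
\<close>

lemma minimal_universal_representatives:
  assumes A: "minimal_universal M A" and "class_embeds M C" "class_embeds C A"
  obtains F where "F ` A \<subseteq> C" "inj_on F A" "\<forall>Z\<in>A. isometric (F Z) Z"
proof -
  have "\<forall>Z\<in>A. \<exists>X. X \<in> C \<and> isometric X Z"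
    by (meson minimal_universal_isometric_member[OF assms])
  then obtain F where F: "\<forall>Z\<in>A. F Z \<in> C \<and> isometric (F Z) Z"
    by metis
  have "inj_on F A"
  proof (rule inj_onI)
    fix Y Z assume YZ: "Y \<in> A" "Z \<in> A" and eq: "F Y = F Z"
    have "isometric Y (F Y)" "isometric (F Y) Z"
      using F YZ isometric_sym by (blast, metis eq)
    then have "embeds Y (F Y)" "embeds (F Y) Z"
      by (simp_all add: isometric_imp_embeds)
    then have "embeds Y Z"
      by (rule embeds_trans)
    then show "Y = Z"
      by (rule minimal_universal_eqI[OF A YZ])
  qed
  with F that show thesis
    by blast
qed

text \<open>
  Although minimality only speaks of universality from \<open>M\<close> into \<open>A\<close>, it also bounds \<open>A\<close> from
  above: its members are isometric copies of members of \<open>M\<close>, and these embed wherever \<open>M\<close> does.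
\<close>

lemma minimal_universal_class_embeds:
  assumes A: "minimal_universal M A" and B: "class_embeds M B"
  shows "class_embeds A B"
proof -
  have univ: "class_embeds M A"
    using A by (simp add: minimal_universal_def)
  have "class_embeds A M"
    unfolding class_embeds_def
  proof
    fix Z assume "Z \<in> A"
    then obtain X where "X \<in> M" "isometric X Z"
      by (rule minimal_universal_isometric_member[OF A class_embeds_refl univ])
    then show "\<exists>X\<in>M. embeds Z X"
      by (blast intro: isometric_imp_embeds isometric_sym)
  qed
  then show ?thesis
    using B by (rule class_embeds_trans)
qed

lemma minimal_universal_unique:
  assumes A: "minimal_universal M A" and B: "minimal_universal M B"
  shows "class_isomorphic A B"
proof -
  have univ: "class_embeds M A" "class_embeds M B"
    using A B by (simp_all add: minimal_universal_def)
  have BA: "class_embeds B A" and AB: "class_embeds A B"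
    using minimal_universal_class_embeds A B univ by blast+
  obtain F where F: "F ` A \<subseteq> B" "inj_on F A" "\<forall>Z\<in>A. isometric (F Z) Z"
    by (rule minimal_universal_representatives[OF A univ(2) BA])
  have "B \<subseteq> F ` A"
  proof
    fix W assume "W \<in> B"
    then obtain Z where Z: "Z \<in> A" "isometric Z W"
      by (rule minimal_universal_isometric_member[OF B univ(1) AB])
    have "embeds (F Z) Z" "embeds Z W"
      using F(3) Z by (simp_all add: isometric_imp_embeds)
    then have "embeds (F Z) W"
      by (rule embeds_trans)
    moreover have "F Z \<in> B"
      using F(1) Z(1) by blast
    ultimately have "F Z = W"
      using minimal_universal_eqI[OF B _ \<open>W \<in> B\<close>] by simp
    with Z(1) show "W \<in> F ` A"
      by blast
  qed
  with F show ?thesis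
    unfolding class_isomorphic_def bij_betw_def by blast
qed

lemma minimal_universal_isomorphic_subclass:
  assumes A: "minimal_universal M A"
  obtains B where "B \<subseteq> M" "class_isomorphic A B"
proof -
  have univ: "class_embeds M A"
    using A by (simp add: minimal_universal_def)
  from A class_embeds_refl univ obtain F where "F ` A \<subseteq> M" "inj_on F A" "\<forall>Z\<in>A. isometric (F Z) Z"
    by (rule minimal_universal_representatives)
  then show thesis
    by (intro that[of "F ` A"]) (auto simp: class_isomorphic_def bij_betw_def)
qed

theorem theorem5p13:
  fixes M :: "'m ext_metric set"
  assumes "M \<noteq> {}"
  shows "(\<forall>(A :: 'a ext_metric set) (B :: 'b ext_metric set).
            minimal_universal M A \<and> minimal_universal M B \<longrightarrow> class_isomorphic A B) \<and>
         (\<forall>A :: 'a ext_metric set.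
            minimal_universal M A \<longrightarrow> (\<exists>B. B \<subseteq> M \<and> class_isomorphic A B))"
proof (intro conjI allI impI)
  fix A :: "'a ext_metric set" and B :: "'b ext_metric set"
  assume "minimal_universal M A \<and> minimal_universal M B"
  then show "class_isomorphic A B"
    using minimal_universal_unique by blast
next
  fix A :: "'a ext_metric set"
  assume "minimal_universal M A"
  then obtain B where "B \<subseteq> M" "class_isomorphic A B"
    by (rule minimal_universal_isomorphic_subclass)
  then show "\<exists>B. B \<subseteq> M \<and> class_isomorphic A B"
    by blast
qed

end
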